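(* Let $x,y\in\mathbb{R}$ and $n\in\mathbb{N}$. i) If $x,y>0$, then the $(n+1)\times(n+1)$ matrix $R_n[x,y]$ with entries $$(R_n[x,y])_{ij}=x^{j-1}y^{i-1}\binom{i+j-2}{j-1},\qquad 1\le i,j\le n+1,$$ is strictly totally positive and its bidiagonal decomposition can be computed (from $x,y$) to high relative accuracy. ii) If $xy>0$, then the $(n+1)\times(n+1)$ matrix $\Psi_n[x,y]$ with entries $$(\Psi_n[x,y])_{ij}=x^{i-j}y^{i+j-2}\binom{i+j-2}{j-1},\qquad 1\le i,j\le n+1,$$ is strictly totally positive and its bidiagonal decomposition can be computed (from $x,y$) to high relative accuracy.
   Context: A real matrix is strictly totally positive (STP) if all its minors are positive. Bidiagonal decomposition: an $N\times N$ STP matrix $A$ has a unique factorization $$A=F_{N-1}F_{N-2}\cdots F_1\,D\,G_1\cdots G_{N-2}G_{N-1},$$ where $D=\mathrm{diag}(p_{11},\ldots,p_{NN})$ has positive diagonal entries; for each $i\in\{1,\ldots,N-1\}$, $F_i$ is the lower bidiagonal matrix with all diagonal entries equal to $1$ and whose subdiagonal entry in position $(r,r-1)$ is $0$ for $2\le r\le i$ and $m_{r,r-i}$ for $i+1\le r\le N$; and $G_i$ is the upper bidiagonal matrix with all diagonal entries equal to $1$ and whose superdiagonal entry in position $(r-1,r)$ is $0$ for $2\le r\le i$ and $\widetilde m_{r,r-i}$ for $i+1\le r\le N$, with all $m_{ij},\widetilde m_{ij}$ positive. Computing the bidiagonal decomposition means computing all the numbers $m_{ij},\widetilde m_{ij}$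 ($i>j$) and $p_{ii}$. Here $N=n+1$. High relative accuracy (HRA): computations are carried out in floating-point arithmetic with unit round-off $u$ (standard model: each elementary operation is performed with relative error at most $u$). A real value $z$ is obtained with HRA if the computed value $\tilde z$ satisfies $|z-\tilde z|/|z|<Ku$, where $K$ is a positive constant independent of the arithmetic precision; for a collection of numbers this is required of each of them. An algorithm can be performed with HRA if it only includes products, divisions, sums of numbers of the same sign, and subtractions of initial data. *)

theory Defs
  imports Jordan_Normal_Form.Determinant Jordan_Normal_Form.DL_Submatrix
begin

definition strictly_totally_positive :: "real mat \<Rightarrow> bool" where
  "strictly_totally_positive A \<longleftrightarrow>
     (\<forall>I J. I \<subseteq> {0..<dim_row A} \<and> J \<subseteq> {0..<dim_col A} \<and> card I = card J \<and> I \<noteq> {}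
        \<longrightarrow> det (submatrix A I J) > 0)"

(* Matrix positions (r, c) count from 0, so they stand for the position (r + 1, c + 1) in the
   usual notation; the parameters m, mt and p keep their usual indices, counted from 1. *)

definition bidiag_lower :: "nat \<Rightarrow> (nat \<Rightarrow> nat \<Rightarrow> real) \<Rightarrow> nat \<Rightarrow> real mat" where
  "bidiag_lower N m i = mat N N (\<lambda>(r, c).
     if r = c then 1
     else if r = c + 1 \<and> i + 1 \<le> r + 1 then m (r + 1) (r + 1 - i)
     else 0)"

definition bidiag_upper :: "nat \<Rightarrow> (nat \<Rightarrow> nat \<Rightarrow> real) \<Rightarrow> nat \<Rightarrow> real mat" where
  "bidiag_upper N mt i = mat N N (\<lambda>(r, c).
     if r = c then 1
     else if c = r + 1 \<and> i + 1 \<le> c + 1 then mt (c + 1) (c + 1 - i)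
     else 0)"

(* A = F_(N-1) ... F_1 D G_1 ... G_(N-1) with positive parameters. *)

definition is_bidiagonal_decomposition ::
    "nat \<Rightarrow> real mat \<Rightarrow> (nat \<Rightarrow> nat \<Rightarrow> real) \<Rightarrow> (nat \<Rightarrow> nat \<Rightarrow> real) \<Rightarrow> (nat \<Rightarrow> real) \<Rightarrow> bool" where
  "is_bidiagonal_decomposition N A m mt p \<longleftrightarrow>
     (\<forall>i j. 1 \<le> j \<and> j < i \<and> i \<le> N \<longrightarrow> m i j > 0 \<and> mt i j > 0) \<and>
     (\<forall>i. 1 \<le> i \<and> i \<le> N \<longrightarrow> p i > 0) \<and>
     A = foldr (*) (map (bidiag_lower N m) (rev [1..<N])
                    @ [mat_diag N (\<lambda>k. p (k + 1))]
                    @ map (bidiag_upper N mt) [1..<N])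
           (1\<^sub>m N)"

(* Arithmetic algorithms on two real input data, given by the expression they evaluate.
   Every node is rounded independently, so a repeated subexpression may receive different
   roundings; this only enlarges the set of computed values that has to be controlled. *)

datatype arith_expr =
    DataX
  | DataY
  | Const int
  | Add arith_expr arith_expr
  | Sub arith_expr arith_expr
  | Mul arith_expr arith_expr
  | Div arith_expr arith_expr

definition roundings :: "real \<Rightarrow> real \<Rightarrow> real set" where
  "roundings u z = {z * (1 + \<delta>) | \<delta>. \<bar>\<delta>\<bar> \<le> u}"

(* All values that may be computed with unit round-off u in the standard model. The data x and y
   are exact; constants are rounded. *)

primrec fl_values :: "real \<Rightarrow> real \<Rightarrow> real \<Rightarrow> arith_expr \<Rightarrow> real set" where
  "fl_values u x y DataX = {x}"
| "fl_values u x y DataY = {y}"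
| "fl_values u x y (Const c) = roundings u (of_int c)"
| "fl_values u x y (Add e e') =
     (\<Union>a \<in> fl_values u x y e. \<Union>b \<in> fl_values u x y e'. roundings u (a + b))"
| "fl_values u x y (Sub e e') =
     (\<Union>a \<in> fl_values u x y e. \<Union>b \<in> fl_values u x y e'. roundings u (a - b))"
| "fl_values u x y (Mul e e') =
     (\<Union>a \<in> fl_values u x y e. \<Union>b \<in> fl_values u x y e'. roundings u (a * b))"
| "fl_values u x y (Div e e') =
     (\<Union>a \<in> fl_values u x y e. \<Union>b \<in> fl_values u x y e'. roundings u (a / b))"

(* No possible execution divides by 0; this rules out any use of the convention a / 0 = 0. *)

primrec fl_safe :: "real \<Rightarrow> real \<Rightarrow> real \<Rightarrow> arith_expr \<Rightarrow> bool" where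
  "fl_safe u x y DataX \<longleftrightarrow> True"
| "fl_safe u x y DataY \<longleftrightarrow> True"
| "fl_safe u x y (Const c) \<longleftrightarrow> True"
| "fl_safe u x y (Add e e') \<longleftrightarrow> fl_safe u x y e \<and> fl_safe u x y e'"
| "fl_safe u x y (Sub e e') \<longleftrightarrow> fl_safe u x y e \<and> fl_safe u x y e'"
| "fl_safe u x y (Mul e e') \<longleftrightarrow> fl_safe u x y e \<and> fl_safe u x y e'"
| "fl_safe u x y (Div e e') \<longleftrightarrow>
     fl_safe u x y e \<and> fl_safe u x y e' \<and> 0 \<notin> fl_values u x y e'"

(* The algorithm, the constant K and the threshold u0 must not depend on the data: with a
   K depending on x and y, practically every algorithm would qualify. As u tends to 0, the bound
   forces the algorithm to compute f x y exactly in exact arithmetic. *)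

definition hra_computable :: "(real \<times> real) set \<Rightarrow> (real \<Rightarrow> real \<Rightarrow> real) \<Rightarrow> bool" where
  "hra_computable S f \<longleftrightarrow>
     (\<exists>e. \<exists>K > 0. \<exists>u0 > 0. \<forall>u. 0 < u \<and> u < u0 \<longrightarrow>
        (\<forall>(x, y) \<in> S. f x y \<noteq> 0 \<and> fl_safe u x y e \<and>
           (\<forall>v \<in> fl_values u x y e. \<bar>f x y - v\<bar> / \<bar>f x y\<bar> < K * u)))"

definition bidiagonal_decomposition_hra ::
    "nat \<Rightarrow> (real \<times> real) set \<Rightarrow> (real \<Rightarrow> real \<Rightarrow> real mat) \<Rightarrow> bool" where
  "bidiagonal_decomposition_hra N S A \<longleftrightarrow>
     (\<exists>m mt p.
        (\<forall>(x, y) \<in> S. is_bidiagonal_decomposition N (A x y) (m x y) (mt x y) (p x y)) \<and>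
        (\<forall>i j. 1 \<le> j \<and> j < i \<and> i \<le> N \<longrightarrow>
           hra_computable S (\<lambda>x y. m x y i j) \<and> hra_computable S (\<lambda>x y. mt x y i j)) \<and>
        (\<forall>i. 1 \<le> i \<and> i \<le> N \<longrightarrow> hra_computable S (\<lambda>x y. p x y i)))"

(* With row and column indices counted from 0, the exponents j - 1, i - 1 and i + j - 2 of the
   usual notation become j, i and i + j. *)

definition R_mat :: "nat \<Rightarrow> real \<Rightarrow> real \<Rightarrow> real mat" where
  "R_mat n x y = mat (n + 1) (n + 1) (\<lambda>(i, j). x ^ j * y ^ i * real ((i + j) choose j))"

definition Psi_mat :: "nat \<Rightarrow> real \<Rightarrow> real \<Rightarrow> real mat" where
  "Psi_mat n x y = mat (n + 1) (n + 1)
     (\<lambda>(i, j). x powi (int i - int j) * y ^ (i + j) * real ((i + j) choose j))"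

end

(* Both matrices have entries a^i b^j binom(i+j, j) with a, b > 0 (counting from 0): a = y, b = x
   for R_n and a = xy, b = y/x for Psi_n. Hence all multipliers are a and b, the pivots are the
   powers of ab, and computing them takes only products and one quotient of the data.

   For total positivity it suffices to take a = b = 1. Since
   binom(i+j, j) = (SUM l <= i. binom(l+j-1, l)), subtracting from each chosen row the preceding
   one and expanding multilinearly writes a minor with rows i_0 < i_1 < ... as the sum of the
   minors of binom(l+j-1, l) with rows l_0 <= i_0 < l_1 <= i_1 < ... . These are minors of the same
   kind with all column indices decreased by 1 or, if column 0 is involved, either 0 or minors of
   smaller size. *)

theory Submission
  imports Defs "HOL-Library.FuncSet"
begin

section \<open>Minors of the symmetric Pascal matrix\<close>

lemma det_scale_rows_cols:
  fixes M :: "nat \<Rightarrow> nat \<Rightarrow> 'a :: comm_ring_1"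
  shows "det (mat k k (\<lambda>(r, s). \<alpha> r * \<beta> s * M r s)) =
    (\<Prod>r<k. \<alpha> r) * (\<Prod>s<k. \<beta> s) * det (mat k k (\<lambda>(r, s). M r s))"
proof -
  have "signof p * (\<Prod>i = 0..<k. \<alpha> i * \<beta> (p i) * M i (p i)) =
      (\<Prod>r<k. \<alpha> r) * (\<Prod>s<k. \<beta> s) * (signof p * (\<Prod>i = 0..<k. M i (p i)))"
    if "p permutes {0..<k}" for p
    using prod.permute[OF that, of \<beta>]
    by (simp add: prod.distrib atLeast0LessThan o_def mult_ac)
  moreover have "p i < k" if "p permutes {0..<k}" "i < k" for p i
    using permutes_in_image[OF that(1), of i] that(2) by simp
  ultimately show ?thesis
    by (simp add: det_def'[of _ k] sum_distrib_left)
qed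

text \<open>Multilinearity in all rows at once: inside each Leibniz term a product of sums expands
  over the choice functions, and exchanging the two sums leaves one determinant per choice.\<close>

lemma det_rows_sum:
  fixes w :: "nat \<Rightarrow> nat \<Rightarrow> 'a :: comm_ring_1"
  assumes "\<And>r. r < k \<Longrightarrow> finite (S r)"
  shows "det (mat k k (\<lambda>(r, s). \<Sum>l\<in>S r. w l s)) =
    (\<Sum>l\<in>PiE {0..<k} S. det (mat k k (\<lambda>(r, s). w (l r) s)))"
proof -
  have [simp]: "p i < k" if "p permutes {0..<k}" "i < k" for p i
    using permutes_in_image[OF that(1), of i] that(2) by simp
  have "det (mat k k (\<lambda>(r, s). \<Sum>l\<in>S r. w l s)) =
      (\<Sum>p | p permutes {0..<k}. signof p * (\<Prod>i = 0..<k. \<Sum>l\<in>S i. w l (p i)))"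
    by (simp add: det_def'[of _ k])
  also have "\<dots> = (\<Sum>p | p permutes {0..<k}. \<Sum>l\<in>PiE {0..<k} S.
      signof p * (\<Prod>i = 0..<k. w (l i) (p i)))"
    by (subst prod_sum_PiE) (simp_all add: assms sum_distrib_left)
  also have "\<dots> = (\<Sum>l\<in>PiE {0..<k} S. \<Sum>p | p permutes {0..<k}.
      signof p * (\<Prod>i = 0..<k. w (l i) (p i)))"
    by (rule sum.swap)
  also have "\<dots> = (\<Sum>l\<in>PiE {0..<k} S. det (mat k k (\<lambda>(r, s). w (l r) s)))"
    by (simp add: det_def'[of _ k])
  finally show ?thesis .
qed

text \<open>Partial summation of rows is left multiplication by the lower triangular matrix of ones,
  whose determinant is 1.\<close>

lemma det_partial_sums_rows:
  fixes h :: "nat \<Rightarrow> nat \<Rightarrow> 'a :: comm_ring_1"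
  shows "det (mat k k (\<lambda>(r, s). \<Sum>q\<le>r. h q s)) = det (mat k k (\<lambda>(r, s). h r s))"
proof -
  let ?T = "mat k k (\<lambda>(r, q). if q \<le> r then 1 else 0 :: 'a)"
  let ?H = "mat k k (\<lambda>(r, s). h r s)"
  have "mat k k (\<lambda>(r, s). \<Sum>q\<le>r. h q s) = ?T * ?H"
  proof (rule eq_matI)
    fix r s assume "r < dim_row (?T * ?H)" "s < dim_col (?T * ?H)"
    then have rs: "r < k" "s < k" by auto
    have "(\<Sum>q\<le>r. h q s) = (\<Sum>q\<in>{0..<k}. if q \<le> r then h q s else 0)"
      using rs by (intro sum.mono_neutral_cong_left) auto
    also have "\<dots> = (?T * ?H) $$ (r, s)"
      using rs by (auto simp: scalar_prod_def intro!: sum.cong)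
    finally show "mat k k (\<lambda>(r, s). \<Sum>q\<le>r. h q s) $$ (r, s) = (?T * ?H) $$ (r, s)"
      using rs by simp
  qed auto
  moreover have "det ?T = 1"
    by (subst det_lower_triangular[of k]) (auto simp: prod_list_diag_prod)
  ultimately show ?thesis
    by (simp add: det_mult[of _ k])
qed

lemma det_first_col_zero:
  fixes A :: "'a :: comm_ring_1 mat"
  assumes A: "A \<in> carrier_mat (Suc k) (Suc k)" and z: "\<And>r. 0 < r \<Longrightarrow> r \<le> k \<Longrightarrow> A $$ (r, 0) = 0"
  shows "det A = A $$ (0, 0) * det (mat k k (\<lambda>(r, s). A $$ (Suc r, Suc s)))"
proof -
  have "det A = (\<Sum>i<Suc k. A $$ (i, 0) * cofactor A i 0)"
    using laplace_expansion_column[OF A, of 0] by simp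
  also have "\<dots> = A $$ (0, 0) * cofactor A 0 0"
    using z by (subst sum.lessThan_Suc_shift) (simp add: Suc_le_eq)
  also have "mat_delete A 0 0 = mat k k (\<lambda>(r, s). A $$ (Suc r, Suc s))"
    using A by (intro eq_matI) (auto simp: mat_delete_def)
  then have "cofactor A 0 0 = det (mat k k (\<lambda>(r, s). A $$ (Suc r, Suc s)))"
    by (simp add: cofactor_def)
  finally show ?thesis .
qed

text \<open>For \<open>j > 0\<close> this is the hockey-stick identity. For \<open>j = 0\<close>
  truncated subtraction keeps it true: the term at \<open>l = 0\<close> is
  \<open>(0 - 1) choose 0 = 1\<close>, and \<open>(l - 1) choose l\<close> vanishes for every other
  \<open>l\<close>.\<close>

lemma choose_eq_sum_choose_pred: "((i + j) choose j) = (\<Sum>l\<le>i. (l + j - 1) choose l)"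
proof (cases j)
  case 0
  have "(\<Sum>l\<le>i. (l - 1) choose l) = (\<Sum>l\<le>i. if l = 0 then 1 else 0)"
    by (intro sum.cong) (auto simp: binomial_eq_0)
  then show ?thesis using 0 by simp
next
  case (Suc c)
  have "(\<Sum>l\<le>i. (l + j - 1) choose l) = (\<Sum>l\<le>i. (c + l) choose l)"
    by (simp add: Suc add.commute)
  also have "\<dots> = (Suc c + i) choose i"
    using sum_choose_lower[of c i] by simp
  also have "\<dots> = (i + j) choose j"
    using binomial_symmetric[of j "i + j"] Suc by (simp add: add.commute)
  finally show ?thesis by simp
qed

text \<open>The index sets cut \<open>{..\<iota> r}\<close> into consecutive blocks, one for each
  row up to \<open>r\<close>, so row \<open>r\<close> is a partial sum of block sums. Undoing the
  partial summation and expanding multilinearly leaves one index per block.\<close>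

lemma det_pascal_eq_sum:
  fixes \<iota> \<gamma> :: "nat \<Rightarrow> nat"
  assumes \<iota>: "\<And>r s. r < s \<Longrightarrow> s < k \<Longrightarrow> \<iota> r < \<iota> s"
  shows "det (mat k k (\<lambda>(r, s). real ((\<iota> r + \<gamma> s) choose \<gamma> s))) =
    (\<Sum>l\<in>PiE {0..<k} (\<lambda>r. if r = 0 then {..\<iota> 0} else {\<iota> (r - 1)<..\<iota> r}).
       det (mat k k (\<lambda>(r, s). real ((l r + \<gamma> s - 1) choose l r))))"
proof -
  let ?S = "\<lambda>r. if r = 0 then {..\<iota> 0} else {\<iota> (r - 1)<..\<iota> r}"
  let ?h = "\<lambda>l s. real ((l + \<gamma> s - 1) choose l)"
  have *: "(\<Sum>q\<le>r. \<Sum>l\<in>?S q. ?h l s) = (\<Sum>l\<le>\<iota> r. ?h l s)" if "r < k" for r s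
    using that
  proof (induction r)
    case (Suc r)
    have "{..\<iota> (Suc r)} = {..\<iota> r} \<union> {\<iota> r<..\<iota> (Suc r)}"
      using \<iota>[of r "Suc r"] Suc.prems by auto
    then have "(\<Sum>l\<le>\<iota> (Suc r). ?h l s) = (\<Sum>l\<le>\<iota> r. ?h l s) + (\<Sum>l\<in>?S (Suc r). ?h l s)"
      by (simp add: sum.union_disjoint ivl_disj_int)
    then show ?case using Suc by simp
  qed simp
  have "mat k k (\<lambda>(r, s). real ((\<iota> r + \<gamma> s) choose \<gamma> s)) =
      mat k k (\<lambda>(r, s). \<Sum>q\<le>r. \<Sum>l\<in>?S q. ?h l s)"
    by (rule cong_mat) (simp_all only: * split choose_eq_sum_choose_pred of_nat_sum)
  then show ?thesis
    by (simp only: det_partial_sums_rows) (rule det_rows_sum, simp)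
qed

text \<open>Successive rows draw their indices from successive disjoint blocks. This lets the
  summands of the expansion meet the monotonicity hypothesis of an induction.\<close>

lemma interlacing_strict_mono:
  fixes \<iota> l :: "nat \<Rightarrow> nat"
  assumes \<iota>: "\<And>r s. r < s \<Longrightarrow> s < k \<Longrightarrow> \<iota> r < \<iota> s"
    and l: "l \<in> PiE {0..<k} (\<lambda>r. if r = 0 then {..\<iota> 0} else {\<iota> (r - 1)<..\<iota> r})"
    and rs: "r < s" "s < k"
  shows "l r < l s"
proof -
  have "l r \<le> \<iota> r"
    using PiE_mem[OF l, of r] rs by (auto split: if_splits)
  also have "\<iota> r \<le> \<iota> (s - 1)"
  proof -
    have "r = s - 1 \<or> r < s - 1" using rs by auto
    then show ?thesis using rs by (elim disjE) (auto intro!: less_imp_le \<iota>)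
  qed
  also have "\<iota> (s - 1) < l s"
    using PiE_mem[OF l, of s] rs by auto
  finally show ?thesis .
qed

lemma det_pascal_pos:
  fixes \<iota> \<gamma> :: "nat \<Rightarrow> nat"
  assumes "\<And>r s. r < s \<Longrightarrow> s < k \<Longrightarrow> \<iota> r < \<iota> s" and "\<And>r s. r < s \<Longrightarrow> s < k \<Longrightarrow> \<gamma> r < \<gamma> s"
  shows "det (mat k k (\<lambda>(r, s). real ((\<iota> r + \<gamma> s) choose \<gamma> s))) > 0"
  using assms
proof (induction k arbitrary: \<iota> \<gamma>)
  case 0
  show ?case by (simp add: det_def')
next
  case (Suc k)
  \<comment> \<open>The least column index is the measure of an inner induction at fixed size; each
    expansion lowers it by one.\<close>
  define d where "d = \<gamma> 0"
  from d_def Suc.prems show ?case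
  proof (induction d arbitrary: \<iota> \<gamma>)
    case 0
    note \<iota> = "0.prems"(2) and \<gamma> = "0.prems"(3)
    let ?S = "\<lambda>r. if r = 0 then {..\<iota> 0} else {\<iota> (r - 1)<..\<iota> r}"
    let ?D = "\<lambda>l. det (mat (Suc k) (Suc k) (\<lambda>(r, s). real ((l r + \<gamma> s - 1) choose l r)))"
    \<comment> \<open>As \<open>\<gamma> 0 = 0\<close>, the entry of column 0 in row
      \<open>r\<close> is \<open>(l r - 1) choose l r\<close>, which is nonzero only for
      \<open>l r = 0\<close>. Since \<open>l\<close> increases strictly, this can happen in row 0
      only.\<close>
    have D: "?D l \<ge> 0 \<and> (l 0 = 0 \<longrightarrow> ?D l > 0)" if l: "l \<in> PiE {0..<Suc k} ?S" for l
    proof -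
      have mono: "l r < l s" if "r < s" "s < Suc k" for r s
        by (rule interlacing_strict_mono[OF \<iota> l that])
      have l_pos: "l r > 0" if "0 < r" "r \<le> k" for r
        using mono[of 0 r] that by simp
      have \<gamma>_pos: "\<gamma> (Suc s) > 0" if "s < k" for s
        using \<gamma>[of 0 "Suc s"] that by simp
      have "?D l = real ((l 0 - 1) choose l 0) *
          det (mat k k (\<lambda>(r, s). real ((l (Suc r) + \<gamma> (Suc s) - 1) choose l (Suc r))))"
        using l_pos "0.prems"(1)
        by (subst det_first_col_zero) (auto simp: binomial_eq_0 intro!: arg_cong[where f = det] eq_matI)
      \<comment> \<open>Symmetry of the binomial coefficient restores the Pascal form with columns
        lowered by one; \<open>\<gamma> (Suc s) > 0\<close> makes the truncated subtraction
        exact.\<close>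
      also have "mat k k (\<lambda>(r, s). real ((l (Suc r) + \<gamma> (Suc s) - 1) choose l (Suc r))) =
          mat k k (\<lambda>(r, s). real ((l (Suc r) + (\<gamma> (Suc s) - 1)) choose (\<gamma> (Suc s) - 1)))"
      proof (rule cong_mat)
        fix r s assume "r < k" "s < k"
        then show "(case (r, s) of (r, s) \<Rightarrow> real ((l (Suc r) + \<gamma> (Suc s) - 1) choose l (Suc r))) =
          (case (r, s) of (r, s) \<Rightarrow> real ((l (Suc r) + (\<gamma> (Suc s) - 1)) choose (\<gamma> (Suc s) - 1)))"
          using \<gamma>_pos[of s] binomial_symmetric[of "l (Suc r)" "l (Suc r) + (\<gamma> (Suc s) - 1)"] by simp
      qed simp_all
      finally have "?D l = real ((l 0 - 1) choose l 0) *
          det (mat k k (\<lambda>(r, s). real ((l (Suc r) + (\<gamma> (Suc s) - 1)) choose (\<gamma> (Suc s) - 1))))" .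
      moreover have "det (mat k k
          (\<lambda>(r, s). real ((l (Suc r) + (\<gamma> (Suc s) - 1)) choose (\<gamma> (Suc s) - 1)))) > 0"
      \<comment> \<open>This is the outer hypothesis: row and column 0 are gone and the size is
        \<open>k\<close>.\<close>
      proof (rule Suc.IH)
        fix r s assume rs: "r < s" "s < k"
        show "l (Suc r) < l (Suc s)" using mono rs by simp
        show "\<gamma> (Suc r) - 1 < \<gamma> (Suc s) - 1"
          using \<gamma>[of "Suc r" "Suc s"] \<gamma>_pos[of r] rs by simp
      qed
      ultimately show ?thesis by simp
    qed
    \<comment> \<open>Summands with \<open>l 0 > 0\<close> vanish, so a strictly positive one has to
      be exhibited: 0 from the first block and the right end of every other block.\<close>
    let ?l = "\<lambda>r\<in>{0..<Suc k}. if r = 0 then 0 else \<iota> r"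
    have mem: "?l \<in> PiE {0..<Suc k} ?S"
      using \<iota> by auto
    have "sum ?D (PiE {0..<Suc k} ?S) > 0"
      using D mem D[OF mem] by (intro sum_pos2[OF _ mem]) (auto intro!: finite_PiE)
    then show ?case
      by (subst det_pascal_eq_sum) (use \<iota> in auto)
  next
    case (Suc d)
    note \<iota> = Suc.prems(2) and \<gamma> = Suc.prems(3)
    let ?S = "\<lambda>r. if r = 0 then {..\<iota> 0} else {\<iota> (r - 1)<..\<iota> r}"
    let ?D = "\<lambda>l. det (mat (Suc k) (Suc k) (\<lambda>(r, s). real ((l r + \<gamma> s - 1) choose l r)))"
    \<comment> \<open>All column indices are positive now, so every summand is a Pascal minor of the
      same size with columns lowered by one, and the inner hypothesis applies.\<close>
    have D: "?D l > 0" if l: "l \<in> PiE {0..<Suc k} ?S" for l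
    proof -
      have \<gamma>_pos: "\<gamma> s > 0" if "s < Suc k" for s
        using \<gamma>[of 0 s] Suc.prems(1) that by (cases "s = 0") auto
      have "mat (Suc k) (Suc k) (\<lambda>(r, s). real ((l r + \<gamma> s - 1) choose l r)) =
          mat (Suc k) (Suc k) (\<lambda>(r, s). real ((l r + (\<gamma> s - 1)) choose (\<gamma> s - 1)))"
      proof (rule cong_mat)
        fix r s assume "r < Suc k" "s < Suc k"
        then show "(case (r, s) of (r, s) \<Rightarrow> real ((l r + \<gamma> s - 1) choose l r)) =
          (case (r, s) of (r, s) \<Rightarrow> real ((l r + (\<gamma> s - 1)) choose (\<gamma> s - 1)))"
          using \<gamma>_pos[of s] binomial_symmetric[of "l r" "l r + (\<gamma> s - 1)"] by simp
      qed simp_all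
      moreover have "det (mat (Suc k) (Suc k)
          (\<lambda>(r, s). real ((l r + (\<gamma> s - 1)) choose (\<gamma> s - 1)))) > 0"
      proof (rule Suc.IH)
        show "d = \<gamma> 0 - 1" using Suc.prems(1) by simp
      next
        fix r s assume rs: "r < s" "s < Suc k"
        show "l r < l s" by (rule interlacing_strict_mono[OF \<iota> l rs])
        show "\<gamma> r - 1 < \<gamma> s - 1" using \<gamma>[OF rs] \<gamma>_pos[of r] rs by simp
      qed
      ultimately show ?thesis by simp
    qed
    \<comment> \<open>The right ends of the blocks show that the sum of positive terms is not
      empty.\<close>
    have "(\<lambda>r\<in>{0..<Suc k}. \<iota> r) \<in> PiE {0..<Suc k} ?S"
      using \<iota> by auto
    then have "PiE {0..<Suc k} ?S \<noteq> {}" by blast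
    then have "sum ?D (PiE {0..<Suc k} ?S) > 0"
      using D by (intro sum_pos) (auto intro!: finite_PiE split: if_splits)
    then show ?case
      by (subst det_pascal_eq_sum) (use \<iota> in auto)
  qed
qed

text \<open>The symmetric Pascal matrix between two diagonal matrices, which hold the powers of
  \<open>a\<close> and of \<open>b\<close>.\<close>

definition scaled_pascal :: "nat \<Rightarrow> real \<Rightarrow> real \<Rightarrow> real mat" where
  "scaled_pascal N a b = mat N N (\<lambda>(i, j). a ^ i * b ^ j * real ((i + j) choose j))"

text \<open>\<open>pick\<close> enumerates the chosen rows and columns increasingly. The powers of
  \<open>a\<close> and \<open>b\<close> leave the minor as positive row and column factors, and a
  minor of the Pascal matrix remains.\<close>

lemma strictly_totally_positive_scaled_pascal:
  assumes "a > 0" "b > 0"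
  shows "strictly_totally_positive (scaled_pascal N a b)"
  unfolding strictly_totally_positive_def
proof (intro allI impI, elim conjE)
  fix I J :: "nat set"
  let ?A = "scaled_pascal N a b"
  assume "I \<subseteq> {0..<dim_row ?A}" "J \<subseteq> {0..<dim_col ?A}" and card: "card I = card J"
  then have IJ: "I \<subseteq> {0..<N}" "J \<subseteq> {0..<N}" by (auto simp: scaled_pascal_def)
  define k where "k = card I"
  \<comment> \<open>The dimensions of \<open>submatrix\<close> are cardinalities of these
    intersections.\<close>
  have eqs: "{i. i < N \<and> i \<in> I} = I" "{j. j < N \<and> j \<in> J} = J" using IJ by auto
  have "pick I r < N" "pick J r < N" if "r < k" for r
    using pick_in_set_le[of r I] pick_in_set_le[of r J] that IJ card by (auto simp: k_def)
  then have "submatrix ?A I J = mat k k (\<lambda>(r, s). a ^ pick I r * b ^ pick J s *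
      real ((pick I r + pick J s) choose pick J s))"
    unfolding submatrix_def using card
    by (intro eq_matI) (auto simp: scaled_pascal_def eqs k_def)
  moreover have "det (mat k k (\<lambda>(r, s). real ((pick I r + pick J s) choose pick J s))) > 0"
    using card by (intro det_pascal_pos pick_mono_le) (auto simp: k_def)
  ultimately show "det (submatrix ?A I J) > 0"
    using assms by (simp add: det_scale_rows_cols prod_pos)
qed

section \<open>Bidiagonal decomposition\<close>

text \<open>An elementary row operation: from row \<open>i\<close> on, \<open>a\<close> times the
  preceding row is added. With \<open>i \<ge> 1\<close> it never reaches row 0, where the truncated
  \<open>r - 1\<close> would point back to the row itself.\<close>

lemma bidiag_lower_mult:
  assumes B: "B \<in> carrier_mat N K" and r: "r < N" and c: "c < K" and i: "i \<ge> 1"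
  shows "(bidiag_lower N (\<lambda>_ _. a) i * B) $$ (r, c) =
    B $$ (r, c) + (if i \<le> r then a * B $$ (r - 1, c) else 0)"
proof -
  have "(bidiag_lower N (\<lambda>_ _. a) i * B) $$ (r, c) =
      (\<Sum>q\<in>{0..<N}. (if r = q then 1 else if r = q + 1 \<and> i \<le> r then a else 0) * B $$ (q, c))"
    using B r c by (auto simp: bidiag_lower_def scalar_prod_def intro!: sum.cong)
  also have "\<dots> = (\<Sum>q\<in>{0..<N}. (if q = r then B $$ (r, c) else 0) +
      (if q = r - 1 then (if i \<le> r then a * B $$ (r - 1, c) else 0) else 0))"
    using i by (intro sum.cong) auto
  also have "\<dots> = B $$ (r, c) + (if i \<le> r then a * B $$ (r - 1, c) else 0)"
    using r by (simp add: sum.distrib less_imp_diff_less)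
  finally show ?thesis .
qed

lemma bidiag_upper_mult:
  assumes B: "B \<in> carrier_mat N K" and r: "r < N" and c: "c < K"
  shows "(bidiag_upper N (\<lambda>_ _. b) i * B) $$ (r, c) =
    B $$ (r, c) + (if i \<le> r + 1 \<and> r + 1 < N then b * B $$ (r + 1, c) else 0)"
proof -
  have "(bidiag_upper N (\<lambda>_ _. b) i * B) $$ (r, c) =
      (\<Sum>q\<in>{0..<N}. (if r = q then 1 else if q = r + 1 \<and> i \<le> q then b else 0) * B $$ (q, c))"
    using B r c by (auto simp: bidiag_upper_def scalar_prod_def intro!: sum.cong)
  also have "\<dots> = (\<Sum>q\<in>{0..<N}. (if q = r then B $$ (r, c) else 0) +
      (if q = r + 1 then (if i \<le> r + 1 then b * B $$ (r + 1, c) else 0) else 0))"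
    by (intro sum.cong) auto
  also have "\<dots> = B $$ (r, c) + (if i \<le> r + 1 \<and> r + 1 < N then b * B $$ (r + 1, c) else 0)"
    using r by (simp add: sum.distrib)
  finally show ?thesis .
qed

text \<open>The induction runs down from \<open>i = N\<close>, because each further factor is
  multiplied on the left. It adds \<open>b\<close> times the next row, which is Pascal's rule for
  the binomial coefficients.\<close>

lemma foldr_bidiag_upper:
  assumes "1 \<le> i" "i \<le> N"
  shows "foldr (*) (map (bidiag_upper N (\<lambda>_ _. b)) [i..<N]) (1\<^sub>m N) = mat N N (\<lambda>(r, c).
    if r + 1 < i then (if r = c then 1 else 0)
    else if c < r then 0 else b ^ (c - r) * real ((c + 1 - i) choose (r + 1 - i)))"
  using assms(2,1)
proof (induction i rule: inc_induct)
  case base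
  show ?case by (rule eq_matI) auto
next
  case (step i)
  let ?Y = "\<lambda>i. mat N N (\<lambda>(r, c). if r + 1 < i then (if r = c then 1 else 0)
    else if c < r then 0 else b ^ (c - r) * real ((c + 1 - i) choose (r + 1 - i)))"
  have "bidiag_upper N (\<lambda>_ _. b) i * ?Y (Suc i) = ?Y i"
  proof (rule eq_matI)
    fix r c assume "r < dim_row (?Y i)" "c < dim_col (?Y i)"
    then have rc: "r < N" "c < N" by auto
    have pw: "b * b ^ (c - Suc r) = b ^ (c - r)" if "r < c"
      using that by (metis Suc_diff_Suc power_Suc)
    \<comment> \<open>Rows above the range of the factor stay as they are; row \<open>i - 1\<close>
      is still a row of the identity and becomes a row of powers of \<open>b\<close>; Pascal's rule
      handles the rest.\<close>
    consider "r + 1 < i" | "r + 1 = i" | "i \<le> r" by linarith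
    then show "(bidiag_upper N (\<lambda>_ _. b) i * ?Y (Suc i)) $$ (r, c) = ?Y i $$ (r, c)"
    proof cases
      case 1
      then show ?thesis using rc by (subst bidiag_upper_mult[of _ N N]) auto
    next
      case 2
      then show ?thesis using rc pw by (subst bidiag_upper_mult[of _ N N]) auto
    next
      case 3
      then obtain q where q: "r = i + q" using le_Suc_ex by blast
      \<comment> \<open>Offsets from \<open>i\<close> make all truncated subtractions exact.\<close>
      have "c < r \<or> c = r \<or> (\<exists>t. c = i + (q + Suc t))"
        using q less_iff_Suc_add[of r c] by auto
      then show ?thesis using rc q pw step.prems
        by (subst bidiag_upper_mult[of _ N N]) (auto simp: Suc_diff_le algebra_simps)
    qed
  qed (auto simp: bidiag_upper_def)
  then show ?case using step by (simp add: upt_conv_Cons)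
qed

text \<open>Each factor raises the upper index of the binomial coefficient by one, by Pascal's rule,
  in the rows that it changes. Row \<open>r\<close> is changed by the factors 1 to \<open>r\<close>
  only, hence the minimum.\<close>

lemma foldr_bidiag_lower:
  assumes "1 \<le> i"
  shows "foldr (*) (map (bidiag_lower N (\<lambda>_ _. a)) (rev [1..<i]))
      (mat N N (\<lambda>(r, c). a ^ r * b ^ c * real (c choose r))) =
    mat N N (\<lambda>(r, c). a ^ r * b ^ c * real ((c + min (i - 1) r) choose r))"
  using assms
proof (induction i rule: nat_induct_at_least)
  case base
  show ?case by simp
next
  case (Suc i)
  let ?Z = "\<lambda>i. mat N N (\<lambda>(r, c). a ^ r * b ^ c * real ((c + min (i - 1) r) choose r))"
  have "bidiag_lower N (\<lambda>_ _. a) i * ?Z i = ?Z (Suc i)"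
  proof (rule eq_matI)
    fix r c assume "r < dim_row (?Z (Suc i))" "c < dim_col (?Z (Suc i))"
    then have rc: "r < N" "c < N" by auto
    show "(bidiag_lower N (\<lambda>_ _. a) i * ?Z i) $$ (r, c) = ?Z (Suc i) $$ (r, c)"
    proof (cases "i \<le> r")
      case True
      obtain j q where "i = Suc j" "r = Suc q" using True Suc.hyps by (metis Suc_le_D order_trans One_nat_def)
      then show ?thesis using rc True
        by (subst bidiag_lower_mult[of _ N N]) (auto simp: algebra_simps min_def)
    next
      case False
      then have "min (i - 1) r = r" "min i r = r" by auto
      then show ?thesis using rc False Suc.hyps
        by (subst bidiag_lower_mult[of _ N N]) auto
    qed
  qed (auto simp: bidiag_lower_def)
  then show ?case using Suc by simp
qed

text \<open>The product is evaluated from the right: the upper factors give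
  \<open>b ^ (c - r) * (c choose r)\<close>, the diagonal turns the powers into
  \<open>a ^ r * b ^ c\<close>, and the lower factors turn \<open>c choose r\<close> into
  \<open>(c + r) choose r\<close>.\<close>

lemma is_bidiagonal_decomposition_scaled_pascal:
  assumes ab: "a > 0" "b > 0"
  shows "is_bidiagonal_decomposition N (scaled_pascal N a b)
    (\<lambda>_ _. a) (\<lambda>_ _. b) (\<lambda>i. (a * b) ^ (i - 1))"
proof -
  let ?Y = "mat N N (\<lambda>(r, c). if c < r then 0 else b ^ (c - r) * real (c choose r))"
  have Y: "foldr (*) (map (bidiag_upper N (\<lambda>_ _. b)) [1..<N]) (1\<^sub>m N) = ?Y"
  proof (cases "N = 0")
    case False
    then show ?thesis by (subst foldr_bidiag_upper) auto
  qed auto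
  have D: "mat_diag N (\<lambda>k. (a * b) ^ (k + 1 - 1)) * ?Y =
      mat N N (\<lambda>(r, c). a ^ r * b ^ c * real (c choose r))"
  proof -
    have "b ^ r * b ^ (c - r) = b ^ c" if "\<not> c < r" for r c
      using that by (simp flip: power_add)
    then show ?thesis
      by (subst mat_diag_mult_left[of _ N N])
        (auto simp: power_mult_distrib binomial_eq_0 intro!: eq_matI)
  qed
  have L: "foldr (*) (map (bidiag_lower N (\<lambda>_ _. a)) (rev [1..<N]))
      (mat N N (\<lambda>(r, c). a ^ r * b ^ c * real (c choose r))) = scaled_pascal N a b"
  proof (cases "N = 0")
    case False
    \<comment> \<open>After all \<open>N - 1\<close> factors every row has reached its final upper
      index.\<close>
    have "(c + min (N - 1) r) choose r = (r + c) choose c" if "r < N" for r c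
      using that binomial_symmetric[of r "r + c"] min_absorb2[of r "N - 1"] by (simp add: add.commute)
    then show ?thesis
      using False by (subst foldr_bidiag_lower) (auto simp: scaled_pascal_def intro!: eq_matI)
  qed (auto simp: scaled_pascal_def)
  show ?thesis
    unfolding is_bidiagonal_decomposition_def using ab Y D L by simp
qed

section \<open>High relative accuracy\<close>

lemma hra_computable_DataX:
  assumes "\<And>x y. (x, y) \<in> S \<Longrightarrow> x \<noteq> 0"
  shows "hra_computable S (\<lambda>x y. x)"
  unfolding hra_computable_def
  by (rule exI[of _ DataX], intro exI[of _ 1] conjI) (use assms in auto)

lemma hra_computable_DataY:
  assumes "\<And>x y. (x, y) \<in> S \<Longrightarrow> y \<noteq> 0"
  shows "hra_computable S (\<lambda>x y. y)"
  unfolding hra_computable_def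
  by (rule exI[of _ DataY], intro exI[of _ 1] conjI) (use assms in auto)

text \<open>The error is at most \<open>u\<close>; the factor 2 makes the bound strict, as
  \<open>hra_computable\<close> demands.\<close>

lemma roundings_relative_error:
  assumes "v \<in> roundings u z" "z \<noteq> 0" "0 < u"
  shows "\<bar>z - v\<bar> / \<bar>z\<bar> < 2 * u"
proof -
  obtain \<delta> where \<delta>: "v = z * (1 + \<delta>)" "\<bar>\<delta>\<bar> \<le> u"
    using assms(1) by (auto simp: roundings_def)
  have "z - v = - (z * \<delta>)" by (simp add: \<delta>(1) algebra_simps)
  then have "\<bar>z - v\<bar> / \<bar>z\<bar> = \<bar>\<delta>\<bar>" using assms(2) by (simp add: abs_mult)
  then show ?thesis using \<delta>(2) assms(3) by simp
qed

lemma hra_computable_one: "hra_computable S (\<lambda>x y. 1)"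
  unfolding hra_computable_def
  by (rule exI[of _ "Const 1"], rule exI[of _ 2], intro conjI exI[of _ 1])
    (use roundings_relative_error[of _ _ 1] in auto)

text \<open>Both operands are exact data, so the division is safe and only its result is
  rounded.\<close>

lemma hra_computable_data_quotient:
  assumes "\<And>x y. (x, y) \<in> S \<Longrightarrow> x \<noteq> 0 \<and> y \<noteq> 0"
  shows "hra_computable S (\<lambda>x y. y / x)"
  unfolding hra_computable_def
proof (rule exI[of _ "Div DataY DataX"], rule exI[of _ 2], intro conjI exI[of _ 1] allI impI ballI)
  fix u :: real and z assume u: "0 < u \<and> u < 1" and z: "z \<in> S"
  obtain x y where [simp]: "z = (x, y)" by (cases z)
  have "x \<noteq> 0" "y \<noteq> 0" using assms z by auto
  then show "case z of (x, y) \<Rightarrow> y / x \<noteq> 0 \<and> fl_safe u x y (Div DataY DataX) \<and>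
      (\<forall>v\<in>fl_values u x y (Div DataY DataX). \<bar>y / x - v\<bar> / \<bar>y / x\<bar> < 2 * u)"
    using roundings_relative_error[of _ u "y / x"] u by auto
qed auto

lemma relative_error_factor:
  fixes z v \<epsilon> :: real
  assumes "z \<noteq> 0" "\<bar>z - v\<bar> / \<bar>z\<bar> < \<epsilon>"
  obtains \<delta> where "v = z * (1 + \<delta>)" "\<bar>\<delta>\<bar> < \<epsilon>"
proof
  show "v = z * (1 + (v - z) / z)" using assms(1) by (simp add: field_simps)
  show "\<bar>(v - z) / z\<bar> < \<epsilon>" using assms(2) by (simp add: abs_minus_commute)
qed

text \<open>With \<open>u < 1\<close>, second-order terms are absorbed into first-order ones. The
  constant comes from \<open>1 + K + L + K * L = (1 + K) * (1 + L)\<close>, doubled to cover the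
  final rounding.\<close>

lemma product_relative_error:
  fixes K L u \<alpha> \<beta> \<delta> :: real
  assumes "K > 0" "L > 0" "0 < u" "u < 1" "\<bar>\<alpha>\<bar> < K * u" "\<bar>\<beta>\<bar> < L * u" "\<bar>\<delta>\<bar> \<le> u"
  shows "\<bar>(1 + \<alpha>) * (1 + \<beta>) * (1 + \<delta>) - 1\<bar> < 2 * (1 + K) * (1 + L) * u"
proof -
  have 1: "\<bar>\<alpha> * \<beta>\<bar> \<le> K * L * u"
  proof -
    have "\<bar>\<alpha> * \<beta>\<bar> \<le> (K * u) * (L * u)"
      unfolding abs_mult using assms by (intro mult_mono) auto
    also have "\<dots> \<le> (K * u) * (L * 1)" using assms by (intro mult_left_mono) auto
    finally show ?thesis by (simp add: mult_ac)
  qed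
  \<comment> \<open>This is the relative error of the product before its own rounding.\<close>
  define \<eta> where "\<eta> = \<alpha> + \<beta> + \<alpha> * \<beta>"
  have \<eta>: "\<bar>\<eta>\<bar> < (K + L + K * L) * u"
    using 1 assms by (simp add: \<eta>_def algebra_simps)
  have "\<bar>\<eta> * \<delta>\<bar> \<le> \<bar>\<eta>\<bar> * 1"
    unfolding abs_mult using assms by (intro mult_left_mono) auto
  then have "\<bar>\<eta> + \<delta> + \<eta> * \<delta>\<bar> < 2 * (K + L + K * L) * u + u"
    using \<eta> assms by (simp add: algebra_simps)
  also have "\<dots> \<le> 2 * (1 + K) * (1 + L) * u"
    using assms by (simp add: algebra_simps)
  finally show ?thesis
    by (simp add: \<eta>_def algebra_simps)
qed

text \<open>The new constant depends only on the constants of the two factors, so it is again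
  uniform over the data.\<close>

lemma hra_computable_mult:
  assumes "hra_computable S f" "hra_computable S g"
  shows "hra_computable S (\<lambda>x y. f x y * g x y)"
proof -
  obtain e K u1 where K: "K > 0" and u1: "u1 > 0"
    and e: "\<And>u x y. 0 < u \<Longrightarrow> u < u1 \<Longrightarrow> (x, y) \<in> S \<Longrightarrow> f x y \<noteq> 0 \<and> fl_safe u x y e \<and>
        (\<forall>v \<in> fl_values u x y e. \<bar>f x y - v\<bar> / \<bar>f x y\<bar> < K * u)"
    using assms(1) unfolding hra_computable_def by blast
  obtain e' L u2 where L: "L > 0" and u2: "u2 > 0"
    and e': "\<And>u x y. 0 < u \<Longrightarrow> u < u2 \<Longrightarrow> (x, y) \<in> S \<Longrightarrow> g x y \<noteq> 0 \<and> fl_safe u x y e' \<and>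
        (\<forall>v \<in> fl_values u x y e'. \<bar>g x y - v\<bar> / \<bar>g x y\<bar> < L * u)"
    using assms(2) unfolding hra_computable_def by blast
  let ?M = "2 * (1 + K) * (1 + L)"
  have "f x y * g x y \<noteq> 0 \<and> fl_safe u x y (Mul e e') \<and>
      (\<forall>v \<in> fl_values u x y (Mul e e'). \<bar>f x y * g x y - v\<bar> / \<bar>f x y * g x y\<bar> < ?M * u)"
    if u: "0 < u" "u < min 1 (min u1 u2)" and S: "(x, y) \<in> S" for u x y
  proof (intro conjI ballI)
    from u have u': "u < 1" "u < u1" "u < u2" by auto
    note E = e[OF u(1) u'(2) S] and E' = e'[OF u(1) u'(3) S]
    show nz: "f x y * g x y \<noteq> 0" and "fl_safe u x y (Mul e e')"
      using E E' by auto
    fix v assume "v \<in> fl_values u x y (Mul e e')"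
    then obtain a b \<delta> where a: "a \<in> fl_values u x y e" and b: "b \<in> fl_values u x y e'"
      and v: "v = a * b * (1 + \<delta>)" and \<delta>: "\<bar>\<delta>\<bar> \<le> u"
      by (auto simp: roundings_def)
    obtain \<alpha> where \<alpha>: "a = f x y * (1 + \<alpha>)" "\<bar>\<alpha>\<bar> < K * u"
      using relative_error_factor[of "f x y" a] E a by blast
    obtain \<beta> where \<beta>: "b = g x y * (1 + \<beta>)" "\<bar>\<beta>\<bar> < L * u"
      using relative_error_factor[of "g x y" b] E' b by blast
    have "v - f x y * g x y = f x y * g x y * ((1 + \<alpha>) * (1 + \<beta>) * (1 + \<delta>) - 1)"
      by (simp add: v \<alpha>(1) \<beta>(1) algebra_simps)
    then have "\<bar>f x y * g x y - v\<bar> / \<bar>f x y * g x y\<bar> = \<bar>(1 + \<alpha>) * (1 + \<beta>) * (1 + \<delta>) - 1\<bar>"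
      using nz by (subst abs_minus_commute) (simp add: abs_mult)
    also have "\<dots> < ?M * u"
      by (rule product_relative_error[OF K L u(1) u'(1) \<alpha>(2) \<beta>(2) \<delta>])
    finally show "\<bar>f x y * g x y - v\<bar> / \<bar>f x y * g x y\<bar> < ?M * u" .
  qed
  then show ?thesis
    unfolding hra_computable_def using K L u1 u2
    by (intro exI[of _ "Mul e e'"] exI[of _ ?M] conjI exI[of _ "min 1 (min u1 u2)"]) auto
qed

text \<open>Repeated multiplication starting from the rounded constant 1; the error constant may
  depend on \<open>k\<close> but not on the data.\<close>

lemma hra_computable_power:
  assumes "hra_computable S f"
  shows "hra_computable S (\<lambda>x y. f x y ^ k)"
proof (induction k)
  case 0
  show ?case by (simp add: hra_computable_one)
next
  case (Suc k)
  then show ?case using hra_computable_mult[OF assms] by simp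
qed

lemma bidiagonal_decomposition_hra_scaled_pascal:
  assumes A: "\<And>x y. (x, y) \<in> S \<Longrightarrow> A x y = scaled_pascal N (a x y) (b x y)"
    and pos: "\<And>x y. (x, y) \<in> S \<Longrightarrow> a x y > 0 \<and> b x y > 0"
    and hra: "hra_computable S a" "hra_computable S b"
  shows "bidiagonal_decomposition_hra N S A"
  unfolding bidiagonal_decomposition_hra_def
proof (intro exI conjI)
  \<comment> \<open>This goal fixes the three witnesses; the accuracy goals that remain concern only
    \<open>a\<close>, \<open>b\<close> and powers of their product.\<close>
  show "\<forall>(x, y) \<in> S. is_bidiagonal_decomposition N (A x y) ((\<lambda>x y _ _. a x y) x y)
      ((\<lambda>x y _ _. b x y) x y) ((\<lambda>x y i. (a x y * b x y) ^ (i - 1)) x y)"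
    using A pos by (auto intro!: is_bidiagonal_decomposition_scaled_pascal[unfolded One_nat_def])
qed (use hra in \<open>auto intro!: hra_computable_power hra_computable_mult\<close>)

section \<open>The two matrices of the theorem as scaled Pascal matrices\<close>

lemma R_mat_eq: "R_mat n x y = scaled_pascal (n + 1) y x"
  by (simp add: R_mat_def scaled_pascal_def mult.commute)

lemma Psi_mat_eq:
  assumes "x \<noteq> 0"
  shows "Psi_mat n x y = scaled_pascal (n + 1) (x * y) (y / x)"
proof -
  have "x powi (int i - int j) * y ^ (i + j) = (x * y) ^ i * (y / x) ^ j" for i j
    using assms by (simp add: power_int_diff power_mult_distrib power_divide power_add)
  then show ?thesis by (simp add: Psi_mat_def scaled_pascal_def)
qed

theorem corollary11:
  fixes n :: nat
  shows "((\<forall>x y. 0 < x \<and> 0 < y \<longrightarrow> strictly_totally_positive (R_mat n x y)) \<and>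
          bidiagonal_decomposition_hra (n + 1) {(x, y). 0 < x \<and> 0 < y} (R_mat n)) \<and>
         ((\<forall>x y. 0 < x * y \<longrightarrow> strictly_totally_positive (Psi_mat n x y)) \<and>
          bidiagonal_decomposition_hra (n + 1) {(x, y). 0 < x * y} (Psi_mat n))"
proof -
  \<comment> \<open>Both data may be negative here, so positivity is available for
    \<open>x * y\<close> and \<open>y / x\<close> but not for \<open>x\<close> and \<open>y\<close>
    themselves.\<close>
  have quotient_pos: "x \<noteq> 0" "y \<noteq> 0" "0 < y / x" if "0 < x * y" for x y :: real
    using that by (auto simp: zero_less_mult_iff zero_less_divide_iff)
  have "bidiagonal_decomposition_hra (n + 1) {(x, y). 0 < x \<and> 0 < y} (R_mat n)"
    by (rule bidiagonal_decomposition_hra_scaled_pascal[where a = "\<lambda>x y. y" and b = "\<lambda>x y. x"])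
      (auto simp: R_mat_eq intro: hra_computable_DataX hra_computable_DataY)
  moreover have "bidiagonal_decomposition_hra (n + 1) {(x, y). 0 < x * y} (Psi_mat n)"
    by (rule bidiagonal_decomposition_hra_scaled_pascal
        [where a = "\<lambda>x y. x * y" and b = "\<lambda>x y. y / x"])
      (auto simp: Psi_mat_eq quotient_pos intro!: hra_computable_mult hra_computable_data_quotient
        hra_computable_DataX hra_computable_DataY)
  ultimately show ?thesis
    by (simp add: R_mat_eq Psi_mat_eq quotient_pos strictly_totally_positive_scaled_pascal)
qed

end
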